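(* Let $i<j<k$ be indices in $\{1,\dots,n\}$ and consider the following inequalities in $(x,Y)$: (T31) $-\ell_iY_{jk} + (\ell_j - u_j)Y_{ik} + \ell_i\ell_kx_j + (u_j - \ell_j)\ell_kx_i + \ell_iu_jx_k - \ell_iu_j\ell_k \leq 0$; (T32) $(\ell_j - u_j)Y_{ik} - \ell_kY_{ij} + \ell_i\ell_kx_j + u_j\ell_kx_i +\ell_i(u_j - \ell_j)x_k - \ell_iu_j\ell_k \leq 0$; (T33) $- \ell_iY_{jk} +(u_k - \ell_k)Y_{ij} + \ell_i\ell_kx_j +u_j(\ell_k - u_k)x_i + \ell_iu_jx_k - \ell_iu_j\ell_k \leq 0$; (T34) $(u_i - \ell_i) Y_{jk} - \ell_kY_{ij} + \ell_i\ell_kx_j + u_j\ell_kx_i +u_j(\ell_i -u_i)x_k - \ell_iu_j\ell_k \leq 0$; (T35) $- u_jY_{ik} + u_j\ell_kx_i + \ell_iu_jx_k - \ell_iu_j\ell_k \leq 0$; (T36) $(u_i - \ell_i)Y_{jk} - u_jY_{ik} + (u_k -\ell_k) Y_{ij} + (\ell_i\ell_k - u_iu_k)x_j + u_j\ell_kx_i + \ell_iu_jx_k - \ell_iu_j\ell_k \leq 0$. Then (T36) cuts feasible solutions of $(P_{S_0,\ldots,S_m})$ (that is, it is violated by some feasible solution of $(P_{S_0,\ldots,S_m})$), while (T31), (T32), (T33), (T34) and (T35) are redundant for $(P_{S_0,\ldots,S_m})$ (that is, they are satisfied by every feasible solution of it).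
   Context: Problem $(P)$ is: minimize $\langle Q_0,xx^T\rangle+c_0^Tx$ over $x\in\mathbb{R}^n$ subject to $\langle Q_r,xx^T\rangle+c_r^Tx\le b_r$ for $r=1,\dots,m$ and $\ell_p\le x_p\le u_p$ for $p=1,\dots,n$. Here $Q_0,\dots,Q_m$ are symmetric $n\times n$ real matrices, $c_0,\dots,c_m\in\mathbb{R}^n$, $b\in\mathbb{R}^m$, $u\in\mathbb{R}^n$, $\ell\in\mathbb{R}_+^n$, the feasible domain of $(P)$ is assumed non-empty, and $\langle A,B\rangle=\sum_{p,q}a_{pq}b_{pq}$. Let $S_0,\dots,S_m$ be any symmetric positive semidefinite $n\times n$ matrices. The convex relaxation $(P_{S_0,\ldots,S_m})$ of $(P)$ is the problem of minimizing $\langle S_0,xx^T\rangle+c_0^Tx+\langle Q_0-S_0,Y\rangle$ over $(x,Y)\in\mathbb{R}^n\times\mathbb{R}^{n\times n}$ subject to: - $\ell_p\le x_p\le u_p$ for all $p$; - $\langle S_r,xx^T\rangle+c_r^Tx+\langle Q_r-S_r,Y\rangle\le b_r$ for $r=1,\dots,m$; - $Y_{qp}=Y_{pq}$ for all $p<q$; - the McCormick inequalities, for all $1\le p\le q\le n$: $Y_{pq}-u_qx_p-\ell_px_q+u_q\ell_p\le 0$, $Y_{pq}-u_px_q-\ell_qx_p+u_p\ell_q\le 0$, $-Y_{pq}+u_qx_p+u_px_q-u_pu_q\le 0$, $-Y_{pq}+\ell_qx_p+\ell_px_q-\ell_p\ell_q\le 0$.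
   Formalization: The claim that (T36) cuts feasible solutions is false for some instances (e.g. ℓ=u, or tight b); it is proved when ℓ_p<u_p for p=i,j,k and every b_r is at least some threshold (no condition on b if m=0). Redundancy of (T31)–(T35) is proved for every instance. *)

theory Defs
  imports "HOL-Analysis.Analysis"
begin

(* The coordinates 1, ..., n are the elements of a finite linearly ordered type 'n.
   The inner product of two matrices of type real^'n^'n is the entrywise sum
   of all A$p$q * B$p$q. *)

definition outer :: "real^'n \<Rightarrow> real^'n^'n" where
  "outer x = (\<chi> p q. x $ p * x $ q)"

definition symmetric_matrix :: "real^'n^'n \<Rightarrow> bool" where
  "symmetric_matrix A \<longleftrightarrow> transpose A = A"

definition psd :: "real^'n^'n \<Rightarrow> bool" where
  "psd A \<longleftrightarrow> symmetric_matrix A \<and> (\<forall>v. 0 \<le> v \<bullet> (A *v v))"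

definition in_box :: "real^'n \<Rightarrow> real^'n \<Rightarrow> real^'n \<Rightarrow> bool" where
  "in_box l u x \<longleftrightarrow> (\<forall>p. l $ p \<le> x $ p \<and> x $ p \<le> u $ p)"

(* The index 0 of Q and c carries the objective function, which plays no role in
   feasibility; the constraints are indexed by 1, ..., m. *)

definition feasible_P ::
  "nat \<Rightarrow> (nat \<Rightarrow> real^'n^'n) \<Rightarrow> (nat \<Rightarrow> real^'n) \<Rightarrow> (nat \<Rightarrow> real) \<Rightarrow> real^'n \<Rightarrow> real^'n
    \<Rightarrow> (real^'n) set" where
  "feasible_P m Q c b l u =
    {x. in_box l u x \<and> (\<forall>r\<in>{1..m}. Q r \<bullet> outer x + c r \<bullet> x \<le> b r)}"

definition instance_P ::
  "nat \<Rightarrow> (nat \<Rightarrow> real^'n^'n) \<Rightarrow> (nat \<Rightarrow> real^'n) \<Rightarrow> (nat \<Rightarrow> real) \<Rightarrow> real^'n \<Rightarrow> real^'n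
    \<Rightarrow> bool" where
  "instance_P m Q c b l u \<longleftrightarrow>
    (\<forall>r\<in>{0..m}. symmetric_matrix (Q r)) \<and> (\<forall>p. 0 \<le> l $ p) \<and> feasible_P m Q c b l u \<noteq> {}"

(* The shorthand real^'n pins the sort of 'n to finite, so types that also need an
   order on the coordinates go through these synonyms. *)

type_synonym 'n rvec = "(real, 'n) vec"
type_synonym 'n rmat = "((real, 'n) vec, 'n) vec"

definition McCormick ::
  "('n::{finite,linorder}) rvec \<Rightarrow> 'n rvec \<Rightarrow> 'n rvec \<Rightarrow> 'n rmat \<Rightarrow> bool" where
  "McCormick l u x Y \<longleftrightarrow> (\<forall>p q. p \<le> q \<longrightarrow>
      Y $ p $ q - u $ q * x $ p - l $ p * x $ q + u $ q * l $ p \<le> 0 \<and>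
      Y $ p $ q - u $ p * x $ q - l $ q * x $ p + u $ p * l $ q \<le> 0 \<and>
      - Y $ p $ q + u $ q * x $ p + u $ p * x $ q - u $ p * u $ q \<le> 0 \<and>
      - Y $ p $ q + l $ q * x $ p + l $ p * x $ q - l $ p * l $ q \<le> 0)"

definition feasible_relax ::
  "nat \<Rightarrow> (nat \<Rightarrow> ('n::{finite,linorder}) rmat) \<Rightarrow> (nat \<Rightarrow> 'n rvec) \<Rightarrow> (nat \<Rightarrow> real)
    \<Rightarrow> 'n rvec \<Rightarrow> 'n rvec \<Rightarrow> (nat \<Rightarrow> 'n rmat)
    \<Rightarrow> ('n rvec \<times> 'n rmat) set" where
  "feasible_relax m Q c b l u S =
    {(x, Y). in_box l u x \<and>
       (\<forall>r\<in>{1..m}. S r \<bullet> outer x + c r \<bullet> x + (Q r - S r) \<bullet> Y \<le> b r) \<and>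
       (\<forall>p q. p < q \<longrightarrow> Y $ q $ p = Y $ p $ q) \<and>
       McCormick l u x Y}"

(* Not every instance admits a violated (T36): the McCormick inequalities imply it when
   l and u agree at i, j or k, and small right-hand sides b can confine the relaxation
   to points satisfying it. *)

definition cuts :: "('a \<Rightarrow> 'b \<Rightarrow> bool) \<Rightarrow> ('a \<times> 'b) set \<Rightarrow> bool" where
  "cuts T F \<longleftrightarrow> (\<exists>(x, Y)\<in>F. \<not> T x Y)"

definition redundant :: "('a \<Rightarrow> 'b \<Rightarrow> bool) \<Rightarrow> ('a \<times> 'b) set \<Rightarrow> bool" where
  "redundant T F \<longleftrightarrow> (\<forall>(x, Y)\<in>F. T x Y)"

context
  fixes l u :: "real^'n" and i j k :: 'n
begin

definition T31 :: "real^'n \<Rightarrow> real^'n^'n \<Rightarrow> bool" where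
  "T31 x Y \<longleftrightarrow>
    - l$i * Y$j$k + (l$j - u$j) * Y$i$k + l$i * l$k * x$j + (u$j - l$j) * l$k * x$i
      + l$i * u$j * x$k - l$i * u$j * l$k \<le> 0"

definition T32 :: "real^'n \<Rightarrow> real^'n^'n \<Rightarrow> bool" where
  "T32 x Y \<longleftrightarrow>
    (l$j - u$j) * Y$i$k - l$k * Y$i$j + l$i * l$k * x$j + u$j * l$k * x$i
      + l$i * (u$j - l$j) * x$k - l$i * u$j * l$k \<le> 0"

definition T33 :: "real^'n \<Rightarrow> real^'n^'n \<Rightarrow> bool" where
  "T33 x Y \<longleftrightarrow>
    - l$i * Y$j$k + (u$k - l$k) * Y$i$j + l$i * l$k * x$j + u$j * (l$k - u$k) * x$i
      + l$i * u$j * x$k - l$i * u$j * l$k \<le> 0"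

definition T34 :: "real^'n \<Rightarrow> real^'n^'n \<Rightarrow> bool" where
  "T34 x Y \<longleftrightarrow>
    (u$i - l$i) * Y$j$k - l$k * Y$i$j + l$i * l$k * x$j + u$j * l$k * x$i
      + u$j * (l$i - u$i) * x$k - l$i * u$j * l$k \<le> 0"

definition T35 :: "real^'n \<Rightarrow> real^'n^'n \<Rightarrow> bool" where
  "T35 x Y \<longleftrightarrow>
    - u$j * Y$i$k + u$j * l$k * x$i + l$i * u$j * x$k - l$i * u$j * l$k \<le> 0"

definition T36 :: "real^'n \<Rightarrow> real^'n^'n \<Rightarrow> bool" where
  "T36 x Y \<longleftrightarrow>
    (u$i - l$i) * Y$j$k - u$j * Y$i$k + (u$k - l$k) * Y$i$j
      + (l$i * l$k - u$i * u$k) * x$j + u$j * l$k * x$i + l$i * u$j * x$k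
      - l$i * u$j * l$k \<le> 0"

end

end

theory Submission
  imports Defs
begin

text \<open>
  Write \<open>d = u - l\<close>, \<open>z = x - l\<close>, and let \<open>w p q\<close> be \<open>Y p q\<close> with \<open>x p * x q - z p * z q\<close>
  subtracted, a quantity that is affine in \<open>x\<close>; thus \<open>w p q\<close> stands for the product
  \<open>z p * z q\<close>. The McCormick inequalities become the four inequalities of the
  unit-square envelope of a product, scaled by \<open>d\<close>:
  \<open>0 \<le> w p q\<close>, \<open>d q * z p + d p * z q - d p * d q \<le> w p q\<close>, \<open>w p q \<le> d q * z p\<close>, \<open>w p q \<le> d p * z q\<close>.

  In these coordinates the left-hand sides of (T31) to (T35) are visibly combinations of
  McCormick inequalities with the nonnegative multipliers \<open>l\<close>, \<open>u\<close> and \<open>d\<close>, hence redundant.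
  The left-hand side of (T36) is different: its main part is
  \<open>d i * w j k + d k * w i j - d j * w i k - d i * d k * z j\<close>, which is the triangle inequality of
  the Boolean quadric polytope after scaling, and this involves three pairs of indices at once,
  whereas each McCormick inequality sees only one pair. It is violated, by a margin of
  \<open>d i * d j * d k / 2\<close>, at the familiar half-integral vertex of the McCormick polytope: \<open>x\<close> is the midpoint of the box, \<open>w p q\<close> has its
  largest value \<open>d p * d q / 2\<close> for all pairs except \<open>{i, k}\<close>, and \<open>w i k\<close> has its smallest
  value 0. The rest of the left-hand side of (T36) vanishes there. The quadratic constraints do not exclude this point once their right-hand sides
  are large enough.
\<close>

definition lower_shift_product ::
  "real^'n \<Rightarrow> real^'n \<Rightarrow> real^'n^'n \<Rightarrow> 'n \<Rightarrow> 'n \<Rightarrow> real" where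
  "lower_shift_product l x Y p q = Y$p$q - l$q * x$p - l$p * x$q + l$p * l$q"

lemma McCormick_shifted:
  fixes l u x :: "('n::{finite,linorder}) rvec"
  assumes "McCormick l u x Y" and "p \<le> q"
  shows "0 \<le> lower_shift_product l x Y p q"
    and "(u$q - l$q) * (x$p - l$p) + (u$p - l$p) * (x$q - l$q) - (u$p - l$p) * (u$q - l$q)
           \<le> lower_shift_product l x Y p q"
    and "lower_shift_product l x Y p q \<le> (u$q - l$q) * (x$p - l$p)"
    and "lower_shift_product l x Y p q \<le> (u$p - l$p) * (x$q - l$q)"
proof -
  have "Y$p$q - u$q * x$p - l$p * x$q + u$q * l$p \<le> 0"
    and "Y$p$q - u$p * x$q - l$q * x$p + u$p * l$q \<le> 0"
    and "- Y$p$q + u$q * x$p + u$p * x$q - u$p * u$q \<le> 0"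
    and "- Y$p$q + l$q * x$p + l$p * x$q - l$p * l$q \<le> 0"
    using assms unfolding McCormick_def by blast+
  then show "0 \<le> lower_shift_product l x Y p q"
    and "(u$q - l$q) * (x$p - l$p) + (u$p - l$p) * (x$q - l$q) - (u$p - l$p) * (u$q - l$q)
           \<le> lower_shift_product l x Y p q"
    and "lower_shift_product l x Y p q \<le> (u$q - l$q) * (x$p - l$p)"
    and "lower_shift_product l x Y p q \<le> (u$p - l$p) * (x$q - l$q)"
    unfolding lower_shift_product_def by (simp_all add: algebra_simps)
qed

section \<open>The redundant inequalities\<close>

text \<open>
  After a change of sign, each left-hand side becomes a sum of products of a multiplier with
  the slack of one McCormick inequality.
\<close>

lemma T31_shifted:
  "T31 l u i j k x Y \<longleftrightarrow>
    0 \<le> l$i * lower_shift_product l x Y j k + (u$j - l$j) * lower_shift_product l x Y i k"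
  unfolding T31_def lower_shift_product_def by (simp add: algebra_simps)

lemma T32_shifted:
  "T32 l u i j k x Y \<longleftrightarrow>
    0 \<le> (u$j - l$j) * lower_shift_product l x Y i k + l$k * lower_shift_product l x Y i j"
  unfolding T32_def lower_shift_product_def by (simp add: algebra_simps)

lemma T33_shifted:
  "T33 l u i j k x Y \<longleftrightarrow>
    0 \<le> (u$k - l$k) * ((u$j - l$j) * (x$i - l$i) - lower_shift_product l x Y i j)
       + l$i * (lower_shift_product l x Y j k
           - ((u$k - l$k) * (x$j - l$j) + (u$j - l$j) * (x$k - l$k) - (u$j - l$j) * (u$k - l$k)))"
  unfolding T33_def lower_shift_product_def by (simp add: algebra_simps)

lemma T34_shifted:
  "T34 l u i j k x Y \<longleftrightarrow>
    0 \<le> (u$i - l$i) * ((u$j - l$j) * (x$k - l$k) - lower_shift_product l x Y j k)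
       + l$k * (lower_shift_product l x Y i j
           - ((u$j - l$j) * (x$i - l$i) + (u$i - l$i) * (x$j - l$j) - (u$i - l$i) * (u$j - l$j)))"
  unfolding T34_def lower_shift_product_def by (simp add: algebra_simps)

lemma T35_shifted:
  "T35 l u i j k x Y \<longleftrightarrow> 0 \<le> u$j * lower_shift_product l x Y i k"
  unfolding T35_def lower_shift_product_def by (simp add: algebra_simps)

lemma McCormick_imp_T31_to_T35:
  fixes l u x :: "('n::{finite,linorder}) rvec"
  assumes mc: "McCormick l u x Y" and l: "\<And>p. 0 \<le> l$p" and lu: "\<And>p. l$p \<le> u$p"
    and "i < j" "j < k"
  shows "T31 l u i j k x Y" "T32 l u i j k x Y" "T33 l u i j k x Y"
    "T34 l u i j k x Y" "T35 l u i j k x Y"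
proof -
  have le: "i \<le> j" "j \<le> k" "i \<le> k"
    using \<open>i < j\<close> \<open>j < k\<close> by auto
  note mc_ij = McCormick_shifted[OF mc le(1)]
    and mc_jk = McCormick_shifted[OF mc le(2)]
    and mc_ik = McCormick_shifted[OF mc le(3)]
  have d: "0 \<le> u$p - l$p" for p
    using lu[of p] by simp
  have u: "0 \<le> u$p" for p
    using l[of p] lu[of p] by linarith
  show "T31 l u i j k x Y"
    unfolding T31_shifted by (intro add_nonneg_nonneg mult_nonneg_nonneg l d mc_jk(1) mc_ik(1))
  show "T32 l u i j k x Y"
    unfolding T32_shifted by (intro add_nonneg_nonneg mult_nonneg_nonneg l d mc_ij(1) mc_ik(1))
  show "T33 l u i j k x Y"
    unfolding T33_shifted
    by (intro add_nonneg_nonneg mult_nonneg_nonneg l d) (use mc_ij(3) mc_jk(2) in linarith)+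
  show "T34 l u i j k x Y"
    unfolding T34_shifted
    by (intro add_nonneg_nonneg mult_nonneg_nonneg l d) (use mc_jk(4) mc_ij(2) in linarith)+
  show "T35 l u i j k x Y"
    unfolding T35_shifted by (intro mult_nonneg_nonneg u mc_ik(1))
qed

section \<open>The half-integral point violating (T36)\<close>

text \<open>
  The term with the factor \<open>l$j\<close> is nonpositive by a McCormick inequality, so it
  works against a violation. It vanishes where that inequality is tight, which is the reason
  for taking \<open>w i k = 0\<close> at the midpoint; the other terms are the scaled triangle inequality.
\<close>

lemma T36_shifted:
  "T36 l u i j k x Y \<longleftrightarrow>
    (u$i - l$i) * lower_shift_product l x Y j k + (u$k - l$k) * lower_shift_product l x Y i j
      - (u$j - l$j) * lower_shift_product l x Y i k - (u$i - l$i) * (u$k - l$k) * (x$j - l$j)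
      + l$j * ((u$k - l$k) * (x$i - l$i) + (u$i - l$i) * (x$k - l$k)
               - (u$i - l$i) * (u$k - l$k) - lower_shift_product l x Y i k) \<le> 0"
  unfolding T36_def lower_shift_product_def by (simp add: algebra_simps)

definition box_midpoint :: "real^'n \<Rightarrow> real^'n \<Rightarrow> real^'n" where
  "box_midpoint l u = (\<chi> p. (l$p + u$p) / 2)"

text \<open>
  The sum of the first three terms is the value of \<open>Y p q\<close> at the midpoint for which
  the shifted product vanishes.
\<close>

definition half_integral_matrix :: "real^'n \<Rightarrow> real^'n \<Rightarrow> 'n \<Rightarrow> 'n \<Rightarrow> real^'n^'n" where
  "half_integral_matrix l u i k = (\<chi> p q.
     l$q * box_midpoint l u $ p + l$p * box_midpoint l u $ q - l$p * l$q
     + (if {p, q} = {i, k} then 0 else (u$p - l$p) * (u$q - l$q) / 2))"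

lemma lower_shift_product_half_integral:
  "lower_shift_product l (box_midpoint l u) (half_integral_matrix l u i k) p q =
    (if {p, q} = {i, k} then 0 else (u$p - l$p) * (u$q - l$q) / 2)"
  unfolding lower_shift_product_def half_integral_matrix_def by simp

lemma half_integral_matrix_sym:
  "half_integral_matrix l u i k $ q $ p = half_integral_matrix l u i k $ p $ q"
  by (simp add: half_integral_matrix_def insert_commute mult.commute)

lemma in_box_midpoint:
  assumes "\<And>p. l$p \<le> u$p"
  shows "in_box l u (box_midpoint l u)"
  using assms by (auto simp: in_box_def box_midpoint_def)

lemma McCormick_half_integral:
  fixes l u :: "('n::{finite,linorder}) rvec"
  assumes lu: "\<And>p. l$p \<le> u$p"
  shows "McCormick l u (box_midpoint l u) (half_integral_matrix l u i k)"
proof -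
  let ?x = "box_midpoint l u" and ?Y = "half_integral_matrix l u i k"
  have "?Y$p$q - u$q * ?x$p - l$p * ?x$q + u$q * l$p \<le> 0 \<and>
        ?Y$p$q - u$p * ?x$q - l$q * ?x$p + u$p * l$q \<le> 0 \<and>
        - ?Y$p$q + u$q * ?x$p + u$p * ?x$q - u$p * u$q \<le> 0 \<and>
        - ?Y$p$q + l$q * ?x$p + l$p * ?x$q - l$p * l$q \<le> 0"
    for p q
  proof -
    have "0 \<le> (u$p - l$p) * (u$q - l$q)"
      using lu[of p] lu[of q] by simp
    then show ?thesis
      unfolding half_integral_matrix_def box_midpoint_def
      by (cases "{p, q} = {i, k}")
        (simp_all add: algebra_simps add_divide_distrib diff_divide_distrib)
  qed
  then show ?thesis
    unfolding McCormick_def by blast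
qed

lemma half_integral_violates_T36:
  fixes l u :: "real^'n"
  assumes "l$i < u$i" "l$j < u$j" "l$k < u$k" and "i \<noteq> j" "j \<noteq> k"
  shows "\<not> T36 l u i j k (box_midpoint l u) (half_integral_matrix l u i k)"
proof -
  define D where "D = (u$i - l$i) * (u$j - l$j) * (u$k - l$k)"
  have pairs: "{i, j} \<noteq> {i, k}" "{j, k} \<noteq> {i, k}"
    using \<open>i \<noteq> j\<close> \<open>j \<noteq> k\<close> by (auto simp: doubleton_eq_iff)
  have mid: "box_midpoint l u $ p - l$p = (u$p - l$p) / 2" for p
    by (simp add: box_midpoint_def field_simps)
  \<comment> \<open>With \<open>A\<close>, \<open>B\<close>, \<open>C\<close> the side lengths of the box at \<open>i\<close>, \<open>j\<close>, \<open>k\<close> and \<open>L = l$j\<close>, this is the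
    left-hand side at the midpoint; its two zeros come from the entry for \<open>{i, k}\<close>.\<close>
  have sum: "A * (B * C / 2) + C * (A * B / 2) - B * 0 - A * C * (B / 2)
      + L * (C * (A / 2) + A * (C / 2) - A * C - 0) = A * B * C / 2" for A B C L :: real
    by (simp add: algebra_simps)
  have "T36 l u i j k (box_midpoint l u) (half_integral_matrix l u i k) \<longleftrightarrow> D / 2 \<le> 0"
    unfolding T36_shifted lower_shift_product_half_integral mid D_def
    by (simp only: pairs if_False if_True refl sum)
  moreover have "0 < D"
    using assms by (simp add: D_def)
  ultimately show ?thesis
    by linarith
qed

section \<open>Redundancy and the cut\<close>

lemma instance_P_lower_le_upper:
  assumes "instance_P m Q c b l u"
  shows "l$p \<le> u$p"
  using assms unfolding instance_P_def feasible_P_def in_box_def by (auto intro: order_trans)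

lemma instance_P_mono:
  assumes "instance_P m Q c b l u" and "\<forall>r\<in>{1..m}. b r \<le> b' r"
  shows "instance_P m Q c b' l u"
proof -
  have "feasible_P m Q c b l u \<subseteq> feasible_P m Q c b' l u"
    using assms(2) by (fastforce simp: feasible_P_def)
  then show ?thesis
    using assms(1) unfolding instance_P_def by blast
qed

theorem proposition6:
  fixes m :: nat
    and Q S :: "nat \<Rightarrow> ('n::{finite,linorder}) rmat"
    and c :: "nat \<Rightarrow> 'n rvec"
    and b :: "nat \<Rightarrow> real"
    and l u :: "'n rvec"
    and i j k :: 'n
  assumes "instance_P m Q c b l u"
    and "\<forall>r\<in>{0..m}. psd (S r)"
    and "i < j" and "j < k"
  shows "(l $ i < u $ i \<and> l $ j < u $ j \<and> l $ k < u $ k \<longrightarrow>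
           (\<exists>b\<^sub>0. \<forall>b'. (\<forall>r\<in>{1..m}. b\<^sub>0 r \<le> b' r) \<longrightarrow>
              instance_P m Q c b' l u \<and>
              cuts (T36 l u i j k) (feasible_relax m Q c b' l u S))) \<and>
         redundant (T31 l u i j k) (feasible_relax m Q c b l u S) \<and>
         redundant (T32 l u i j k) (feasible_relax m Q c b l u S) \<and>
         redundant (T33 l u i j k) (feasible_relax m Q c b l u S) \<and>
         redundant (T34 l u i j k) (feasible_relax m Q c b l u S) \<and>
         redundant (T35 l u i j k) (feasible_relax m Q c b l u S)"
proof -
  let ?x = "box_midpoint l u" and ?Y = "half_integral_matrix l u i k"
  have l: "0 \<le> l$p" for p
    using assms(1) by (simp add: instance_P_def)
  have lu: "l$p \<le> u$p" for p
    using assms(1) by (rule instance_P_lower_le_upper)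
  have cut: "\<exists>b\<^sub>0. \<forall>b'. (\<forall>r\<in>{1..m}. b\<^sub>0 r \<le> b' r) \<longrightarrow>
        instance_P m Q c b' l u \<and> cuts (T36 l u i j k) (feasible_relax m Q c b' l u S)"
    if "l$i < u$i" "l$j < u$j" "l$k < u$k"
  proof (intro exI allI impI)
    \<comment> \<open>the bound \<open>b r\<close> keeps the original problem feasible, the other admits the violating point\<close>
    let ?b = "\<lambda>r. max (b r) (S r \<bullet> outer ?x + c r \<bullet> ?x + (Q r - S r) \<bullet> ?Y)"
    fix b'
    assume b': "\<forall>r\<in>{1..m}. ?b r \<le> b' r"
    then have "instance_P m Q c b' l u"
      by (intro instance_P_mono[OF assms(1)]) simp
    moreover have "(?x, ?Y) \<in> feasible_relax m Q c b' l u S"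
      using b' in_box_midpoint[of l u, OF lu] McCormick_half_integral[of l u, OF lu]
      by (simp add: feasible_relax_def half_integral_matrix_sym)
    moreover have "\<not> T36 l u i j k ?x ?Y"
      using that assms(3,4) by (intro half_integral_violates_T36) auto
    ultimately show "instance_P m Q c b' l u \<and>
        cuts (T36 l u i j k) (feasible_relax m Q c b' l u S)"
      unfolding cuts_def by blast
  qed
  have "McCormick l u x Y" if "(x, Y) \<in> feasible_relax m Q c b l u S" for x Y
    using that by (simp add: feasible_relax_def)
  note imp = McCormick_imp_T31_to_T35[OF this l lu assms(3,4)]
  show ?thesis
    unfolding redundant_def using cut imp by blast
qed

end
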